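(* Let $\Omega=\{1,2,\dots,d\}^{\mathbb N}$, let $G$ be the groupoid of the "bigger than two" relation on $\Omega$, and let $\nu$ be the transverse function given by the counting measure on each class. Let $\varphi:\Omega\to\mathbb R$ be a Hölder function which is normalized for the Ruelle operator, let $c(x,y)=\varphi(y)-\varphi(x)$ for $(x,y)\in G$, and let $\beta\in\mathbb R$. Suppose that the Borel probability $\mu$ on $\Omega$ satisfies the $(c,\beta)$-KMS condition for $(G,\nu)$. Let $v:\Omega\to[0,\infty)$ be a Borel function which does not depend on the first coordinate and satisfies $\int v\,d\mu=1$. Then the probability $v(x)\,d\mu(x)$ also satisfies the $(c,\beta)$-KMS condition for $(G,\nu)$.
   Context: Points of $\Omega$ are written $x=(x_1,x_2,x_3,\dots)$; $\Omega$ has the product topology and the metric $d(x,y)=2^{-N}$, with $N$ the smallest index where $x$ and $y$ differ. The bigger than two relation is: $x\sim y$ iff $x_j=y_j$ for all $j\ge 2$. $G=\{(x,y)\in\Omega\times\Omega: x\sim y\}$ with the induced Borel $\sigma$-algebra. For each $x$, $\nu^x$ is the counting measure on the class $\{(j,x_2,x_3,\dots): j=1,\dots,d\}$ of $x$. $I(G,\nu)$ is the set of Borel functions $h:G\to\mathbb C$ with $\max\{\sup_y\int|h(x,y)|\,\nu^y(dx),\ \sup_y\int|h(y,x)|\,\nu^y(dx)\}<\infty$. For $\beta\in\mathbb R$, a probability $M$ on $\Omega$ satisfies the $(c,\beta)$-KMS condition for $(G,\nu)$ if for every $h\in I(G,\nu)$ $$\int\int h(s,x)\,\nu^x(ds)\,dM(x)=\int\int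 h(x,s)\,e^{-\beta c(x,s)}\,\nu^x(ds)\,dM(x).$$ $\varphi$ is normalized if $\mathcal L_\varphi(1)=1$, i.e. $\sum_{a=1}^d e^{\varphi(a,x_1,x_2,\dots)}=1$ for all $x\in\Omega$. *)

theory Defs
  imports "HOL-Probability.Probability"
begin

text \<open>
  Sequences are indexed from 0, so the coordinate \<open>x\<^sub>j\<close> (\<open>j \<ge> 1\<close>) of a point is \<open>x (j - 1)\<close>; in
  particular the first coordinate is \<open>x 0\<close>.
\<close>

type_synonym point = "nat \<Rightarrow> nat"

definition Omega :: "nat \<Rightarrow> point set" where
  "Omega d = {x. \<forall>n. x n \<in> {1..d}}"

text \<open>
  \<open>nat\<close> is discrete and functions carry the product topology, so the Borel \<open>\<sigma>\<close>-algebra of the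
  subspace is that of the product topology on \<open>\<Omega>\<close>.
\<close>

definition borel_Omega :: "nat \<Rightarrow> point measure" where
  "borel_Omega d = restrict_space borel (Omega d)"

text \<open>The successor accounts for the coordinates being numbered from 1 in \<open>d(x,y) = 2\<^sup>-\<^sup>N\<close>.\<close>

definition seq_dist :: "point \<Rightarrow> point \<Rightarrow> real" where
  "seq_dist x y = (if x = y then 0 else (1 / 2) ^ Suc (LEAST n. x n \<noteq> y n))"

definition Holder_on_Omega :: "nat \<Rightarrow> (point \<Rightarrow> real) \<Rightarrow> bool" where
  "Holder_on_Omega d \<phi> \<longleftrightarrow>
     (\<exists>\<alpha> C. 0 < \<alpha> \<and> \<alpha> \<le> 1 \<and>
        (\<forall>x\<in>Omega d. \<forall>y\<in>Omega d. \<bar>\<phi> x - \<phi> y\<bar> \<le> C * seq_dist x y powr \<alpha>))"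

definition prepend :: "nat \<Rightarrow> point \<Rightarrow> point" where
  "prepend a x = case_nat a x"

definition Ruelle :: "nat \<Rightarrow> (point \<Rightarrow> real) \<Rightarrow> (point \<Rightarrow> real) \<Rightarrow> point \<Rightarrow> real" where
  "Ruelle d \<phi> f x = (\<Sum>a = 1..d. exp (\<phi> (prepend a x)) * f (prepend a x))"

definition normalized :: "nat \<Rightarrow> (point \<Rightarrow> real) \<Rightarrow> bool" where
  "normalized d \<phi> \<longleftrightarrow> (\<forall>x\<in>Omega d. Ruelle d \<phi> (\<lambda>_. 1) x = 1)"

definition bigger_than_two :: "point \<Rightarrow> point \<Rightarrow> bool" where
  "bigger_than_two x y \<longleftrightarrow> (\<forall>n\<ge>1. x n = y n)"

definition groupoid_G :: "nat \<Rightarrow> (point \<times> point) set" where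
  "groupoid_G d = {(x, y). x \<in> Omega d \<and> y \<in> Omega d \<and> bigger_than_two x y}"

definition borel_G :: "nat \<Rightarrow> (point \<times> point) measure" where
  "borel_G d = restrict_space borel (groupoid_G d)"

text \<open>
  The class is a finite subset of a Hausdorff space, hence all its subsets are Borel and
  \<open>count_space\<close> is the counting measure on the Borel sets of the class.
\<close>

definition nu :: "nat \<Rightarrow> point \<Rightarrow> point measure" where
  "nu d x = count_space ((\<lambda>j. x(0 := j)) ` {1..d})"

definition I_G_nu :: "nat \<Rightarrow> (point \<times> point \<Rightarrow> complex) set" where
  "I_G_nu d = {h. h \<in> borel_measurable (borel_G d) \<and>
     max (SUP y\<in>Omega d. \<integral>\<^sup>+x. ennreal (cmod (h (x, y))) \<partial>nu d y)
         (SUP y\<in>Omega d. \<integral>\<^sup>+x. ennreal (cmod (h (y, x))) \<partial>nu d y) < \<infinity>}"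

definition borel_probability_on_Omega :: "nat \<Rightarrow> point measure \<Rightarrow> bool" where
  "borel_probability_on_Omega d M \<longleftrightarrow> prob_space M \<and> sets M = sets (borel_Omega d)"

text \<open>
  This is a condition on Borel probability measures \<open>M\<close> on \<open>\<Omega>\<close>. For such \<open>M\<close> and for Borel \<open>c\<close> bounded
  on the groupoid, both outer integrands are measurable and bounded, so neither Bochner integral takes
  its default value.
\<close>

definition KMS :: "nat \<Rightarrow> (point \<times> point \<Rightarrow> real) \<Rightarrow> real \<Rightarrow> point measure \<Rightarrow> bool" where
  "KMS d c \<beta> M \<longleftrightarrow>
     (\<forall>h\<in>I_G_nu d.
        (\<integral>x. (\<integral>s. h (s, x) \<partial>nu d x) \<partial>M) =
        (\<integral>x. (\<integral>s. h (x, s) * complex_of_real (exp (- \<beta> * c (x, s))) \<partial>nu d x) \<partial>M))"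

end

theory Submission
  imports Defs
begin

text \<open>
  A function that does not depend on the first coordinate is constant on the classes of the relation,
  so it can be moved in and out of the inner integrals with respect to \<open>\<nu>\<^sup>x\<close>. If \<open>w\<close> is
  such a function, Borel and bounded, then \<open>(x, y) \<mapsto> w x * h (x, y)\<close> is again a test function (an element of \<open>I(G,\<nu>)\<close>),
  and the KMS condition of \<open>\<mu>\<close> for it is the KMS condition of \<open>w d\<mu>\<close> for \<open>h\<close>
  (lemma \<open>KMS_times_invariant\<close>).

  The density \<open>v\<close> may be unbounded, so this is applied to \<open>w = v * indicator {v \<le> n}\<close> and
  \<open>n\<close> tends to infinity. Dominated convergence applies because both inner integrals are bounded
  Borel functions of \<open>x\<close> while \<open>v\<close> is integrable (lemma \<open>truncation_limit\<close>).
  The bounds come from two facts: the classes have \<open>d\<close> elements, which makes the test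
  functions exactly the bounded Borel functions on \<open>G\<close> (lemma \<open>I_G_nu_iff_bounded\<close>); and
  a Hoelder potential is continuous and of bounded oscillation on \<open>\<Omega>\<close>, so that multiplication by
  \<open>exp (- \<beta> * c)\<close> preserves the space of test functions (lemma \<open>I_G_nu_times_exp\<close>).
\<close>

section \<open>Integration over the classes\<close>

lemma inj_on_first_coordinate: "inj_on (\<lambda>j. x(0 := j)) (A :: nat set)" for x :: point
  by (rule inj_onI) (metis fun_upd_same)

lemma integral_nu:
  fixes f :: "point \<Rightarrow> complex"
  shows "(\<integral>s. f s \<partial>nu d x) = (\<Sum>j = 1..d. f (x(0 := j)))"
  unfolding nu_def
  by (simp add: lebesgue_integral_count_space_finite sum.reindex[OF inj_on_first_coordinate])

lemma nn_integral_nu: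
  "(\<integral>\<^sup>+s. f s \<partial>nu d x) = (\<Sum>j = 1..d. f (x(0 := j)))"
  unfolding nu_def
  by (simp add: nn_integral_count_space_finite sum.reindex[OF inj_on_first_coordinate])

lemma update_first_in_groupoid:
  assumes "x \<in> Omega d" "j \<in> {1..d}"
  shows "(x, x(0 := j)) \<in> groupoid_G d" "(x(0 := j), x) \<in> groupoid_G d"
  using assms by (auto simp: groupoid_G_def bigger_than_two_def Omega_def)

lemma groupoid_update_first:
  assumes "(x, y) \<in> groupoid_G d"
  shows "x 0 \<in> {1..d}" "y(0 := x 0) = x" "y 0 \<in> {1..d}" "x(0 := y 0) = y"
proof -
  have eq: "x n = y n" if "n \<noteq> 0" for n
    using assms that by (auto simp: groupoid_G_def bigger_than_two_def)
  show "y(0 := x 0) = x" "x(0 := y 0) = y"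
    using eq by auto
  show "x 0 \<in> {1..d}" "y 0 \<in> {1..d}"
    using assms unfolding groupoid_G_def Omega_def by blast+
qed

text \<open>
  Each class is finite with \<open>d\<close> elements, so the supremum of the class sums is finite as soon
  as the summands are uniformly bounded; conversely a class sum dominates each of its summands.
\<close>

lemma I_G_nu_iff_bounded:
  "h \<in> I_G_nu d \<longleftrightarrow>
     h \<in> borel_measurable (borel_G d) \<and> (\<exists>B. \<forall>z\<in>groupoid_G d. cmod (h z) \<le> B)"
proof (intro iffI conjI)
  assume h: "h \<in> I_G_nu d"
  then show "h \<in> borel_measurable (borel_G d)"
    by (simp add: I_G_nu_def)
  define S where "S = (SUP y\<in>Omega d. \<integral>\<^sup>+x. ennreal (cmod (h (x, y))) \<partial>nu d y)"
  have fin: "S < \<infinity>"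
    using h by (simp add: I_G_nu_def S_def)
  have "cmod (h (x, y)) \<le> enn2real S" if G: "(x, y) \<in> groupoid_G d" for x y
  proof -
    note xy = groupoid_update_first[OF G]
    have "ennreal (cmod (h (x, y))) = ennreal (cmod (h (y(0 := x 0), y)))"
      by (simp only: xy(2))
    also have "\<dots> \<le> (\<Sum>j = 1..d. ennreal (cmod (h (y(0 := j), y))))"
      using xy(1) by (intro member_le_sum) auto
    also have "\<dots> = (\<integral>\<^sup>+x. ennreal (cmod (h (x, y))) \<partial>nu d y)"
      by (simp add: nn_integral_nu)
    also have "\<dots> \<le> S"
      unfolding S_def using G by (intro SUP_upper) (auto simp: groupoid_G_def)
    finally have "enn2real (ennreal (cmod (h (x, y)))) \<le> enn2real S"
      using fin by (intro enn2real_mono) auto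
    then show ?thesis by simp
  qed
  then show "\<exists>B. \<forall>z\<in>groupoid_G d. cmod (h z) \<le> B"
    by (intro exI[of _ "enn2real S"]) auto
next
  assume *: "h \<in> borel_measurable (borel_G d) \<and> (\<exists>B. \<forall>z\<in>groupoid_G d. cmod (h z) \<le> B)"
  then obtain B where B: "\<And>z. z \<in> groupoid_G d \<Longrightarrow> cmod (h z) \<le> B" by blast
  have sum_le: "(\<Sum>j = 1..d. f j) \<le> of_nat d * ennreal B"
    if "\<And>j. j \<in> {1..d} \<Longrightarrow> f j \<le> ennreal B" for f :: "nat \<Rightarrow> ennreal"
    using sum_bounded_above[of "{1..d}" f "ennreal B"] that by simp
  have "(SUP y\<in>Omega d. \<integral>\<^sup>+x. ennreal (cmod (h (x, y))) \<partial>nu d y) \<le> of_nat d * ennreal B"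
       "(SUP y\<in>Omega d. \<integral>\<^sup>+x. ennreal (cmod (h (y, x))) \<partial>nu d y) \<le> of_nat d * ennreal B"
    by (auto intro!: SUP_least sum_le ennreal_leI B update_first_in_groupoid
        simp: nn_integral_nu simp del: sum_ennreal One_nat_def)
  moreover have "of_nat d * ennreal B < \<infinity>"
    by (simp add: ennreal_mult_less_top of_nat_less_top)
  ultimately show "h \<in> I_G_nu d"
    using * by (auto simp: I_G_nu_def intro: le_less_trans)
qed

section \<open>Measurability\<close>

lemma space_borel_Omega: "space (borel_Omega d) = Omega d"
  by (simp add: borel_Omega_def space_restrict_space)

lemma space_borel_G: "space (borel_G d) = groupoid_G d"
  by (simp add: borel_G_def space_restrict_space)

lemma measurable_fst_borel_G: "fst \<in> borel_G d \<rightarrow>\<^sub>M borel_Omega d"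
  and measurable_snd_borel_G: "snd \<in> borel_G d \<rightarrow>\<^sub>M borel_Omega d"
  unfolding borel_G_def borel_Omega_def
  by (auto intro!: measurable_restrict_space3 borel_measurable_continuous_onI continuous_on_fst
      continuous_on_snd continuous_on_id
      simp: groupoid_G_def)

lemma continuous_on_update_first: "continuous_on UNIV (\<lambda>x :: point. x(0 := j))"
proof (rule continuous_on_coordinatewise_then_product)
  show "continuous_on UNIV (\<lambda>x :: point. (x(0 := j)) i)" for i
    by (cases "i = 0") (auto intro: continuous_on_product_coordinates)
qed

lemma measurable_update_first:
  assumes "j \<in> {1..d}"
  shows "(\<lambda>x. (x, x(0 := j))) \<in> borel_Omega d \<rightarrow>\<^sub>M borel_G d"
    and "(\<lambda>x. (x(0 := j), x)) \<in> borel_Omega d \<rightarrow>\<^sub>M borel_G d"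
  unfolding borel_G_def borel_Omega_def
  by (auto intro!: measurable_restrict_space3 borel_measurable_continuous_onI continuous_on_Pair
      continuous_on_id continuous_on_update_first update_first_in_groupoid[OF _ assms])

lemma class_integral_bounded_measurable:
  assumes h: "h \<in> I_G_nu d"
  shows "(\<lambda>x. \<integral>s. h (x, s) \<partial>nu d x) \<in> borel_measurable (borel_Omega d)"
    and "(\<lambda>x. \<integral>s. h (s, x) \<partial>nu d x) \<in> borel_measurable (borel_Omega d)"
    and "\<exists>B. \<forall>x\<in>Omega d. cmod (\<integral>s. h (x, s) \<partial>nu d x) \<le> B"
    and "\<exists>B. \<forall>x\<in>Omega d. cmod (\<integral>s. h (s, x) \<partial>nu d x) \<le> B"
proof -
  have hm: "h \<in> borel_measurable (borel_G d)"
    using h by (simp add: I_G_nu_iff_bounded)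
  obtain B where B: "\<And>z. z \<in> groupoid_G d \<Longrightarrow> cmod (h z) \<le> B"
    using h by (auto simp: I_G_nu_iff_bounded)
  show "(\<lambda>x. \<integral>s. h (x, s) \<partial>nu d x) \<in> borel_measurable (borel_Omega d)"
    unfolding integral_nu
    by (intro borel_measurable_sum measurable_compose[OF measurable_update_first(1) hm])
  show "(\<lambda>x. \<integral>s. h (s, x) \<partial>nu d x) \<in> borel_measurable (borel_Omega d)"
    unfolding integral_nu
    by (intro borel_measurable_sum measurable_compose[OF measurable_update_first(2) hm])
  have sum_le: "cmod (\<Sum>j = 1..d. f j) \<le> of_nat d * B"
    if "\<And>j. j \<in> {1..d} \<Longrightarrow> cmod (f j) \<le> B" for f :: "nat \<Rightarrow> complex"
    using sum_norm_bound[of "{1..d}" f B] that by simp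
  show "\<exists>B. \<forall>x\<in>Omega d. cmod (\<integral>s. h (x, s) \<partial>nu d x) \<le> B"
       "\<exists>B. \<forall>x\<in>Omega d. cmod (\<integral>s. h (s, x) \<partial>nu d x) \<le> B"
    unfolding integral_nu
    by (intro exI[of _ "of_nat d * B"] ballI sum_le B update_first_in_groupoid; assumption)+
qed

section \<open>Hoelder potentials\<close>

lemma seq_dist_le:
  assumes "\<And>i. i < n \<Longrightarrow> x i = y i"
  shows "seq_dist x y \<le> (1 / 2) ^ n"
proof (cases "x = y")
  case False
  then obtain m where "x m \<noteq> y m" by blast
  then have "x (LEAST n. x n \<noteq> y n) \<noteq> y (LEAST n. x n \<noteq> y n)" by (rule LeastI)
  then have "n \<le> Suc (LEAST n. x n \<noteq> y n)"
    using assms by (meson le_SucI not_less)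
  then show ?thesis
    using False by (simp add: seq_dist_def del: power_Suc)
qed (simp add: seq_dist_def)

lemma seq_dist_nonneg: "0 \<le> seq_dist x y"
  by (simp add: seq_dist_def)

text \<open>
  In the product topology over a discrete space, points near \<open>x\<close> share any prescribed finite
  number of coordinates with \<open>x\<close>, hence are close to \<open>x\<close> in the metric.
\<close>

lemma Holder_continuous_on:
  assumes "Holder_on_Omega d \<phi>"
  shows "continuous_on (Omega d) \<phi>"
proof -
  obtain \<alpha> C where \<alpha>: "0 < \<alpha>" and H:
    "\<And>x y. x \<in> Omega d \<Longrightarrow> y \<in> Omega d \<Longrightarrow> \<bar>\<phi> x - \<phi> y\<bar> \<le> C * seq_dist x y powr \<alpha>"
    using assms by (auto simp: Holder_on_Omega_def)
  have "(\<phi> \<longlongrightarrow> \<phi> x) (at x within Omega d)" if x: "x \<in> Omega d" for x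
  proof (rule tendstoI)
    fix e :: real assume e: "0 < e"
    \<comment> \<open>The powers \<open>2\<^sup>-\<^sup>n\<^sup>\<alpha>\<close> form a geometric sequence of ratio \<open>2\<^sup>-\<^sup>\<alpha> < 1\<close>.\<close>
    define r :: real where "r = (1 / 2) powr \<alpha>"
    have r: "0 \<le> r" "r < 1"
      using \<alpha> powr01_less_one[of "1/2" \<alpha>] by (auto simp: r_def)
    have "(\<lambda>n. \<bar>C\<bar> * r ^ n) \<longlonglongrightarrow> \<bar>C\<bar> * 0"
      using r by (intro tendsto_intros) auto
    then have "\<forall>\<^sub>F n in sequentially. \<bar>C\<bar> * r ^ n < e"
      using e by (simp add: order_tendsto_iff)
    then obtain n where n: "\<bar>C\<bar> * r ^ n < e"
      by (auto simp: eventually_sequentially)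
    have "((\<lambda>y. y i) \<longlongrightarrow> x i) (at x within Omega d)" for i
      using continuous_on_subset[OF continuous_on_product_coordinates[of i] subset_UNIV] x
      by (auto simp: continuous_on_def)
    then have "\<forall>\<^sub>F y in at x within Omega d. y i = x i" for i
      by (simp add: tendsto_discrete)
    then have "\<forall>\<^sub>F y in at x within Omega d. \<forall>i\<in>{..<n}. y i = x i"
      by (intro eventually_ball_finite) auto
    moreover have "\<forall>\<^sub>F y in at x within Omega d. y \<in> Omega d"
      by (auto simp: eventually_at_filter)
    ultimately show "\<forall>\<^sub>F y in at x within Omega d. dist (\<phi> y) (\<phi> x) < e"
    proof eventually_elim
      case (elim y)
      have "dist (\<phi> y) (\<phi> x) \<le> C * seq_dist y x powr \<alpha>"
        using H[OF elim(2) x] by (simp add: dist_real_def)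
      also have "\<dots> \<le> \<bar>C\<bar> * ((1 / 2) ^ n) powr \<alpha>"
        using elim(1) \<alpha> by (intro mult_mono powr_mono2 seq_dist_le seq_dist_nonneg) auto
      also have "((1 / 2) ^ n) powr \<alpha> = r ^ n"
        by (simp add: r_def powr_powr mult.commute flip: powr_realpow)
      finally show ?case using n by linarith
    qed
  qed
  then show ?thesis by (simp add: continuous_on_def)
qed

lemma Holder_measurable:
  assumes "Holder_on_Omega d \<phi>"
  shows "\<phi> \<in> borel_measurable (borel_Omega d)"
  unfolding borel_Omega_def
  by (rule borel_measurable_continuous_on_restrict[OF Holder_continuous_on[OF assms]])

lemma Holder_bounded_oscillation:
  assumes "Holder_on_Omega d \<phi>"
  obtains K where "\<And>x y. x \<in> Omega d \<Longrightarrow> y \<in> Omega d \<Longrightarrow> \<bar>\<phi> x - \<phi> y\<bar> \<le> K"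
proof -
  obtain \<alpha> C where \<alpha>: "0 < \<alpha>" and H:
    "\<And>x y. x \<in> Omega d \<Longrightarrow> y \<in> Omega d \<Longrightarrow> \<bar>\<phi> x - \<phi> y\<bar> \<le> C * seq_dist x y powr \<alpha>"
    using assms by (auto simp: Holder_on_Omega_def)
  have "\<bar>\<phi> x - \<phi> y\<bar> \<le> \<bar>C\<bar>" if "x \<in> Omega d" "y \<in> Omega d" for x y
  proof -
    have "seq_dist x y powr \<alpha> \<le> 1 powr \<alpha>"
      using seq_dist_le[of 0 x y] \<alpha> by (intro powr_mono2 seq_dist_nonneg) auto
    then have "C * seq_dist x y powr \<alpha> \<le> \<bar>C\<bar> * 1"
      by (intro mult_mono) auto
    then show ?thesis using H[OF that] by linarith
  qed
  then show ?thesis by (rule that)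
qed

text \<open>
  This puts the right-hand side of the KMS condition on the same footing as the left-hand side:
  both are class integrals of a test function.
\<close>

lemma I_G_nu_times_exp:
  assumes \<phi>: "Holder_on_Omega d \<phi>"
    and c: "\<And>x y. (x, y) \<in> groupoid_G d \<Longrightarrow> c (x, y) = \<phi> y - \<phi> x"
    and h: "h \<in> I_G_nu d"
  shows "(\<lambda>z. h z * complex_of_real (exp (- \<beta> * c z))) \<in> I_G_nu d"
  unfolding I_G_nu_iff_bounded
proof
  note [measurable] = Holder_measurable[OF \<phi>] measurable_fst_borel_G measurable_snd_borel_G
  have [measurable]: "h \<in> borel_measurable (borel_G d)"
    using h by (simp add: I_G_nu_iff_bounded)
  have "(\<lambda>z. \<phi> (snd z) - \<phi> (fst z)) \<in> borel_measurable (borel_G d)"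
    by measurable
  also have "?this \<longleftrightarrow> c \<in> borel_measurable (borel_G d)"
    using c by (intro measurable_cong) (auto simp: space_borel_G)
  finally have [measurable]: "c \<in> borel_measurable (borel_G d)" .
  show "(\<lambda>z. h z * complex_of_real (exp (- \<beta> * c z))) \<in> borel_measurable (borel_G d)"
    by measurable
  obtain B where B: "\<And>z. z \<in> groupoid_G d \<Longrightarrow> cmod (h z) \<le> B"
    using h by (auto simp: I_G_nu_iff_bounded)
  obtain K where K: "\<And>x y. x \<in> Omega d \<Longrightarrow> y \<in> Omega d \<Longrightarrow> \<bar>\<phi> x - \<phi> y\<bar> \<le> K"
    using Holder_bounded_oscillation[OF \<phi>] by blast
  have "cmod (h z * complex_of_real (exp (- \<beta> * c z))) \<le> B * exp (\<bar>\<beta>\<bar> * K)"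
    if z: "z \<in> groupoid_G d" for z
  proof -
    have "\<bar>c z\<bar> \<le> K"
      using z c[of "fst z" "snd z"] K[of "snd z" "fst z"] by (auto simp: groupoid_G_def)
    then have "\<bar>\<beta>\<bar> * \<bar>c z\<bar> \<le> \<bar>\<beta>\<bar> * K"
      by (intro mult_left_mono) auto
    then have "- \<beta> * c z \<le> \<bar>\<beta>\<bar> * K"
      using abs_ge_minus_self[of "\<beta> * c z"] by (simp add: abs_mult)
    moreover have "0 \<le> B"
      using B[OF z] norm_ge_zero[of "h z"] by linarith
    ultimately show ?thesis
      using B[OF z] by (auto simp: norm_mult intro!: mult_mono)
  qed
  then show "\<exists>B. \<forall>z\<in>groupoid_G d. cmod (h z * complex_of_real (exp (- \<beta> * c z))) \<le> B"
    by blast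
qed

section \<open>Densities constant on the classes\<close>

text \<open>
  The KMS condition is tested on \<open>(x, y) \<mapsto> w x * h (x, y)\<close>. On the left-hand side the
  factor is \<open>w s\<close>, on the right-hand side \<open>w x\<close>; as \<open>w\<close> is constant on the class of
  \<open>x\<close>, both are \<open>w x\<close> and leave the inner integral.
\<close>

lemma KMS_times_invariant:
  assumes KMS: "KMS d c \<beta> \<mu>"
    and sp: "space \<mu> = Omega d"
    and w: "w \<in> borel_measurable (borel_Omega d)"
    and bd: "\<And>x. x \<in> Omega d \<Longrightarrow> \<bar>w x\<bar> \<le> K"
    and inv: "\<And>x y. (x, y) \<in> groupoid_G d \<Longrightarrow> w x = w y"
    and h: "h \<in> I_G_nu d"
  shows "(\<integral>x. w x *\<^sub>R (\<integral>s. h (s, x) \<partial>nu d x) \<partial>\<mu>) =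
    (\<integral>x. w x *\<^sub>R (\<integral>s. h (x, s) * complex_of_real (exp (- \<beta> * c (x, s))) \<partial>nu d x) \<partial>\<mu>)"
proof -
  define g where "g = (\<lambda>z. complex_of_real (w (fst z)) * h z)"
  obtain B where B: "\<And>z. z \<in> groupoid_G d \<Longrightarrow> cmod (h z) \<le> B"
    using h by (auto simp: I_G_nu_iff_bounded)
  have "cmod (g z) \<le> K * B" if z: "z \<in> groupoid_G d" for z
  proof -
    have *: "\<bar>w (fst z)\<bar> \<le> K"
      using z by (intro bd) (auto simp: groupoid_G_def)
    then have "0 \<le> K" by linarith
    with * show ?thesis
      using B[OF z] by (auto simp: g_def norm_mult intro!: mult_mono)
  qed
  moreover have "g \<in> borel_measurable (borel_G d)"
    unfolding g_def using h measurable_compose[OF measurable_fst_borel_G w]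
    by (auto simp: I_G_nu_iff_bounded intro!: borel_measurable_times borel_measurable_of_real)
  ultimately have "g \<in> I_G_nu d"
    unfolding I_G_nu_iff_bounded by blast
  then have eq: "(\<integral>x. (\<integral>s. g (s, x) \<partial>nu d x) \<partial>\<mu>) =
      (\<integral>x. (\<integral>s. g (x, s) * complex_of_real (exp (- \<beta> * c (x, s))) \<partial>nu d x) \<partial>\<mu>)"
    using KMS by (simp add: KMS_def)
  have "(\<integral>s. g (s, x) \<partial>nu d x) = w x *\<^sub>R (\<integral>s. h (s, x) \<partial>nu d x)" if x: "x \<in> Omega d" for x
  proof -
    have "w (x(0 := j)) = w x" if "j \<in> {1..d}" for j
      by (rule inv[OF update_first_in_groupoid(2)[OF x that]])
    then show ?thesis
      by (simp add: integral_nu g_def scaleR_conv_of_real sum_distrib_left)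
  qed
  then have "(\<integral>x. (\<integral>s. g (s, x) \<partial>nu d x) \<partial>\<mu>) = (\<integral>x. w x *\<^sub>R (\<integral>s. h (s, x) \<partial>nu d x) \<partial>\<mu>)"
    by (intro Bochner_Integration.integral_cong) (auto simp: sp)
  moreover have "(\<integral>s. g (x, s) * complex_of_real (exp (- \<beta> * c (x, s))) \<partial>nu d x) =
      w x *\<^sub>R (\<integral>s. h (x, s) * complex_of_real (exp (- \<beta> * c (x, s))) \<partial>nu d x)" for x
    by (simp add: integral_nu g_def scaleR_conv_of_real sum_distrib_left mult.assoc)
  ultimately show ?thesis
    using eq by simp
qed

lemma truncation_limit:
  fixes F :: "'a \<Rightarrow> complex"
  assumes v: "integrable M v" and F: "F \<in> borel_measurable M"
    and B: "\<And>x. x \<in> space M \<Longrightarrow> cmod (F x) \<le> B"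
  shows "(\<lambda>n. \<integral>x. (if \<bar>v x\<bar> \<le> real n then v x else 0) *\<^sub>R F x \<partial>M) \<longlonglongrightarrow> (\<integral>x. v x *\<^sub>R F x \<partial>M)"
proof (rule integral_dominated_convergence[where w = "\<lambda>x. \<bar>v x\<bar> * B"])
  have [measurable]: "v \<in> borel_measurable M" "F \<in> borel_measurable M"
    using v F by auto
  show "(\<lambda>x. v x *\<^sub>R F x) \<in> borel_measurable M"
    "\<And>n. (\<lambda>x. (if \<bar>v x\<bar> \<le> real n then v x else 0) *\<^sub>R F x) \<in> borel_measurable M"
    by measurable
  show "integrable M (\<lambda>x. \<bar>v x\<bar> * B)"
    using v by auto
  show "AE x in M. (\<lambda>n. (if \<bar>v x\<bar> \<le> real n then v x else 0) *\<^sub>R F x) \<longlonglongrightarrow> v x *\<^sub>R F x"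
  proof (intro AE_I2 tendsto_eventually)
    fix x
    obtain N where "\<bar>v x\<bar> \<le> real N"
      using real_arch_simple by blast
    then show "\<forall>\<^sub>F n in sequentially. (if \<bar>v x\<bar> \<le> real n then v x else 0) *\<^sub>R F x = v x *\<^sub>R F x"
      by (auto simp: eventually_sequentially intro!: exI[of _ N])
  qed
  show "AE x in M. norm ((if \<bar>v x\<bar> \<le> real n then v x else 0) *\<^sub>R F x) \<le> \<bar>v x\<bar> * B" for n
  proof (rule AE_I2)
    fix x assume x: "x \<in> space M"
    have "0 \<le> B" using B[OF x] norm_ge_zero[of "F x"] by linarith
    then show "norm ((if \<bar>v x\<bar> \<le> real n then v x else 0) *\<^sub>R F x) \<le> \<bar>v x\<bar> * B"
      using B[OF x] by (auto intro!: mult_left_mono)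
  qed
qed

theorem proposition55:
  fixes d :: nat and \<phi> :: "point \<Rightarrow> real" and c :: "point \<times> point \<Rightarrow> real" and \<beta> :: real
    and \<mu> :: "point measure" and v :: "point \<Rightarrow> real"
  assumes "Holder_on_Omega d \<phi>"
    and "normalized d \<phi>"
    and "\<And>x y. (x, y) \<in> groupoid_G d \<Longrightarrow> c (x, y) = \<phi> y - \<phi> x"
    and "borel_probability_on_Omega d \<mu>"
    and "KMS d c \<beta> \<mu>"
    and "v \<in> borel_measurable (borel_Omega d)"
    and "\<And>x. x \<in> Omega d \<Longrightarrow> 0 \<le> v x"
    and "\<And>x y. x \<in> Omega d \<Longrightarrow> y \<in> Omega d \<Longrightarrow> (\<forall>n\<ge>1. x n = y n) \<Longrightarrow> v x = v y"
    and "(\<integral>x. v x \<partial>\<mu>) = 1"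
  shows "borel_probability_on_Omega d (density \<mu> (\<lambda>x. ennreal (v x))) \<and>
         KMS d c \<beta> (density \<mu> (\<lambda>x. ennreal (v x)))"
proof
  have sets: "sets \<mu> = sets (borel_Omega d)"
    using assms(4) by (simp add: borel_probability_on_Omega_def)
  have sp: "space \<mu> = Omega d"
    using sets_eq_imp_space_eq[OF sets] by (simp add: space_borel_Omega)
  note meas = measurable_cong_sets[OF sets refl]
  have vm [measurable]: "v \<in> borel_measurable \<mu>"
    using assms(6) by (simp add: meas)
  have nonneg: "AE x in \<mu>. 0 \<le> v x"
    using assms(7) by (auto simp: sp intro: AE_I2)
  \<comment> \<open>The Bochner integral of a function that is not integrable is \<open>0\<close>, not \<open>1\<close>.\<close>
  have int: "integrable \<mu> v"
    using assms(9) not_integrable_integral_eq[of \<mu> v] by auto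
  have "(\<integral>\<^sup>+x. ennreal (v x) \<partial>\<mu>) = 1"
    using nn_integral_eq_integral[OF int nonneg] assms(9) by simp
  then have "prob_space (density \<mu> (\<lambda>x. ennreal (v x)))"
    by (intro prob_spaceI) (simp add: emeasure_density cong: nn_integral_cong)
  then show "borel_probability_on_Omega d (density \<mu> (\<lambda>x. ennreal (v x)))"
    by (simp add: borel_probability_on_Omega_def sets)
  show "KMS d c \<beta> (density \<mu> (\<lambda>x. ennreal (v x)))"
    unfolding KMS_def
  proof
    fix h assume h: "h \<in> I_G_nu d"
    define L where "L = (\<lambda>x. \<integral>s. h (s, x) \<partial>nu d x)"
    define R where
      "R = (\<lambda>x. \<integral>s. h (x, s) * complex_of_real (exp (- \<beta> * c (x, s))) \<partial>nu d x)"
    note k = I_G_nu_times_exp[OF assms(1,3) h, of \<beta>]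
    have Lm: "L \<in> borel_measurable \<mu>" and Rm: "R \<in> borel_measurable \<mu>"
      using class_integral_bounded_measurable(2)[OF h] class_integral_bounded_measurable(1)[OF k]
      by (simp_all add: meas L_def R_def)
    obtain B where B: "\<And>x. x \<in> space \<mu> \<Longrightarrow> cmod (L x) \<le> B"
      using class_integral_bounded_measurable(4)[OF h] by (auto simp: sp L_def)
    obtain B' where B': "\<And>x. x \<in> space \<mu> \<Longrightarrow> cmod (R x) \<le> B'"
      using class_integral_bounded_measurable(3)[OF k] by (auto simp: sp R_def)
    have trunc: "(\<integral>x. (if \<bar>v x\<bar> \<le> real n then v x else 0) *\<^sub>R L x \<partial>\<mu>) =
        (\<integral>x. (if \<bar>v x\<bar> \<le> real n then v x else 0) *\<^sub>R R x \<partial>\<mu>)" for n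
      unfolding L_def R_def
    proof (rule KMS_times_invariant[OF assms(5) sp _ _ _ h])
      show "(\<lambda>x. if \<bar>v x\<bar> \<le> real n then v x else 0) \<in> borel_measurable (borel_Omega d)"
        unfolding meas[symmetric] by measurable
      show "\<bar>if \<bar>v x\<bar> \<le> real n then v x else 0\<bar> \<le> real n" for x
        by simp
      show "(if \<bar>v x\<bar> \<le> real n then v x else 0) = (if \<bar>v y\<bar> \<le> real n then v y else 0)"
        if "(x, y) \<in> groupoid_G d" for x y
        using that assms(8)[of x y] by (simp add: groupoid_G_def bigger_than_two_def)
    qed
    have "(\<integral>x. v x *\<^sub>R L x \<partial>\<mu>) = (\<integral>x. v x *\<^sub>R R x \<partial>\<mu>)"
      using truncation_limit[OF int Lm B] truncation_limit[OF int Rm B']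
      unfolding trunc by (rule LIMSEQ_unique)
    then have "(\<integral>x. L x \<partial>density \<mu> (\<lambda>x. ennreal (v x))) =
        (\<integral>x. R x \<partial>density \<mu> (\<lambda>x. ennreal (v x)))"
      by (simp add: integral_density[OF Lm vm nonneg] integral_density[OF Rm vm nonneg])
    then show "(\<integral>x. (\<integral>s. h (s, x) \<partial>nu d x) \<partial>density \<mu> (\<lambda>x. ennreal (v x))) =
        (\<integral>x. (\<integral>s. h (x, s) * complex_of_real (exp (- \<beta> * c (x, s))) \<partial>nu d x)
          \<partial>density \<mu> (\<lambda>x. ennreal (v x)))"
      by (simp add: L_def R_def)
  qed
qed

end
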